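(* The containment problem for $1$-dimensional linear sets with a unary encoding of numbers is in $\mathrm{P}$: given $c,c'\in\mathbb{N}_0$ and finite sets $P,P'\subset\mathbb{N}_0$, all numbers encoded in unary, one can decide in polynomial time whether $L(c,P)\subseteq L(c',P')$.
   Context: $\mathbb{N}_0=\{0,1,2,\dots\}$. For $c\in\mathbb{N}_0$ and a finite set $P=\{p_1,\dots,p_k\}\subset\mathbb{N}_0$, the linear set is $L(c,P)=\{c+\sum_{i=1}^k a_ip_i: a_i\in\mathbb{N}_0\}$. *)

theory Defs
  imports Main "HOL-Computational_Algebra.Polynomial"
begin

section \<open>Linear sets\<close>

definition linear_set :: "nat \<Rightarrow> nat set \<Rightarrow> nat set" where
  "linear_set c P = {c + (\<Sum>p\<in>P. a p * p) | a :: nat \<Rightarrow> nat. True}"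


section \<open>Deterministic multi-tape Turing machines\<close>

text \<open>
  The input alphabet is a finite type \<open>'a\<close>. States and work symbols are natural numbers,
  so that one can quantify existentially over machines; each machine uses only the finitely many
  states and tape symbols in \<open>states M\<close> and \<open>tape_syms M\<close>.
\<close>

datatype 'a tsym = Blank | Inp 'a | Work nat

datatype direction = Lft | Stay | Rgt

record 'a tm =
  num_tapes :: nat
  states :: "nat set"
  tape_syms :: "'a tsym set"
  start :: nat
  acc :: nat
  rej :: nat
  delta :: "nat \<Rightarrow> 'a tsym list \<Rightarrow> nat \<times> ('a tsym \<times> direction) list"

definition wf_tm :: "'a::finite tm \<Rightarrow> bool" where
  "wf_tm M \<longleftrightarrow>
     1 \<le> num_tapes M \<and>
     finite (states M) \<and> {start M, acc M, rej M} \<subseteq> states M \<and> acc M \<noteq> rej M \<and>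
     finite (tape_syms M) \<and> insert Blank (range Inp) \<subseteq> tape_syms M \<and>
     (\<forall>q \<in> states M - {acc M, rej M}. \<forall>ss \<in> lists (tape_syms M).
        length ss = num_tapes M \<longrightarrow>
        (case delta M q ss of (q', as) \<Rightarrow>
           q' \<in> states M \<and> length as = num_tapes M \<and> fst ` set as \<subseteq> tape_syms M))"

text \<open>Tapes are infinite in both directions; a tape comes with the position of its head.\<close>

type_synonym 'a tape = "(int \<Rightarrow> 'a tsym) \<times> int"

type_synonym 'a config = "nat \<times> 'a tape list"

definition read_tape :: "'a tape \<Rightarrow> 'a tsym" where
  "read_tape t = fst t (snd t)"

fun head_offset :: "direction \<Rightarrow> int" where
  "head_offset Lft = -1"
| "head_offset Stay = 0"
| "head_offset Rgt = 1"

definition act_tape :: "'a tsym \<times> direction \<Rightarrow> 'a tape \<Rightarrow> 'a tape" where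
  "act_tape a t = ((fst t)(snd t := fst a), snd t + head_offset (snd a))"

definition tm_step :: "'a tm \<Rightarrow> 'a config \<Rightarrow> 'a config" where
  "tm_step M C =
     (case C of (q, ts) \<Rightarrow>
        if q \<in> {acc M, rej M} then (q, ts)
        else (case delta M q (map read_tape ts) of (q', as) \<Rightarrow> (q', map2 act_tape as ts)))"

definition blank_tape :: "'a tape" where
  "blank_tape = (\<lambda>_. Blank, 0)"

definition input_tape :: "'a list \<Rightarrow> 'a tape" where
  "input_tape w =
     (\<lambda>i. if 0 \<le> i \<and> i < int (length w) then Inp (w ! nat i) else Blank, 0)"

definition init_config :: "'a tm \<Rightarrow> 'a list \<Rightarrow> 'a config" where
  "init_config M w = (start M, input_tape w # replicate (num_tapes M - 1) blank_tape)"

text \<open>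
  Since the accepting and the rejecting state are absorbing for \<^const>\<open>tm_step\<close>, the state
  after \<open>T (length w)\<close> steps is halting iff the machine halts within that many steps.
\<close>

definition decides_in_time :: "'a::finite tm \<Rightarrow> 'a list set \<Rightarrow> (nat \<Rightarrow> nat) \<Rightarrow> bool" where
  "decides_in_time M L T \<longleftrightarrow>
     (\<forall>w. fst ((tm_step M ^^ T (length w)) (init_config M w))
            = (if w \<in> L then acc M else rej M))"

definition class_P :: "'a::finite list set set" where
  "class_P = {L. \<exists>M (p :: nat poly). wf_tm M \<and> decides_in_time M L (poly p)}"


section \<open>The containment problem with unary encoding\<close>

datatype usym = One | Comma | Semicolon

instance usym :: finite
proof
  have "(UNIV :: usym set) = {One, Comma, Semicolon}"
    using usym.exhaust by blast
  then show "finite (UNIV :: usym set)"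
    by (metis finite.emptyI finite.insertI)
qed

definition unary :: "nat \<Rightarrow> usym list" where
  "unary n = replicate n One @ [Comma]"

definition encode_linear :: "nat \<Rightarrow> nat list \<Rightarrow> usym list" where
  "encode_linear c ps = unary c @ concat (map unary ps)"

definition encode_pair :: "nat \<Rightarrow> nat list \<Rightarrow> nat \<Rightarrow> nat list \<Rightarrow> usym list" where
  "encode_pair c ps c' ps' = encode_linear c ps @ [Semicolon] @ encode_linear c' ps'"

text \<open>
  A finite set of periods is given by a list of its elements, in any order and possibly with
  repetitions. Words that do not encode an instance are not in the language.
\<close>

definition unary_containment :: "usym list set" where
  "unary_containment =
     {encode_pair c ps c' ps' | c ps c' ps'.
        linear_set c (set ps) \<subseteq> linear_set c' (set ps')}"

lemma unary_append_inject: "unary m @ xs = unary n @ ys \<longleftrightarrow> m = n \<and> xs = ys"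
proof (induction m arbitrary: n)
  case 0
  then show ?case by (cases n) (auto simp: unary_def)
next
  case (Suc m)
  then show ?case by (cases n) (auto simp: unary_def)
qed

lemma concat_unary_inject: "concat (map unary ps) = concat (map unary qs) \<longleftrightarrow> ps = qs"
proof (induction ps arbitrary: qs)
  case Nil
  then show ?case by (cases qs) (auto simp: unary_def)
next
  case (Cons p ps)
  show ?case
  proof (cases qs)
    case Nil
    then show ?thesis by (simp add: unary_def)
  next
    case (Cons q qs')
    then show ?thesis using Cons.IH by (simp add: unary_append_inject)
  qed
qed

lemma encode_linear_inject:
  "encode_linear c ps = encode_linear d qs \<longleftrightarrow> c = d \<and> ps = qs"
  by (simp add: encode_linear_def unary_append_inject concat_unary_inject)

lemma Semicolon_notin_encode_linear: "Semicolon \<notin> set (encode_linear c ps)"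
  by (auto simp: encode_linear_def unary_def)

lemma append_separator_inject:
  assumes "x \<notin> set xs" "x \<notin> set ys"
  shows "xs @ x # us = ys @ x # vs \<longleftrightarrow> xs = ys \<and> us = vs"
  using assms
proof (induction xs arbitrary: ys)
  case Nil
  then show ?case by (cases ys) auto
next
  case (Cons a xs)
  then show ?case by (cases ys) auto
qed

lemma encode_pair_inject:
  "encode_pair c ps c' ps' = encode_pair d qs d' qs' \<longleftrightarrow>
     c = d \<and> ps = qs \<and> c' = d' \<and> ps' = qs'"
  using Semicolon_notin_encode_linear[of c ps] Semicolon_notin_encode_linear[of d qs]
  by (simp add: encode_pair_def append_separator_inject encode_linear_inject)

lemma encode_pair_in_unary_containment:
  "encode_pair c ps c' ps' \<in> unary_containment \<longleftrightarrow>
     linear_set c (set ps) \<subseteq> linear_set c' (set ps')"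
  by (auto simp: unary_containment_def encode_pair_inject)

lemma length_encode_pair:
  "length (encode_pair c ps c' ps') =
     c + sum_list ps + length ps + c' + sum_list ps' + length ps' + 3"
proof -
  have "length (concat (map unary xs)) = sum_list xs + length xs" for xs
    by (induction xs) (simp_all add: unary_def)
  then show ?thesis
    by (simp add: encode_pair_def encode_linear_def) (simp add: unary_def)
qed

end

(*
  If q > 0 is a period of the right set, then an element of the left set in which some period p
  has a coefficient at least q stays in the left set when q * p is subtracted, and adding q * p
  back is harmless on the right. So a least counterexample to the containment has all coefficients
  below q and is therefore smaller than the square of the input length N. Below this bound the
  two sets are computed on a bit map by a sieve: for each period p, scan the map upwards and
  for every marked n also mark n + p.
*)

theory Submission
  imports Defs "HOL-Library.Countable"
begin

section \<open>Linear sets\<close>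

text \<open>Unary notation helps twice. The length \<open>N\<close> exceeds the sum of all numbers
  of the instance, so a map of \<open>N * N\<close> cells is both large enough and of polynomial
  size. And a block of \<open>p\<close> ones is a ruler: a head that walks along it while the head
  on the map moves in step shifts the latter by \<open>p\<close>, so the machine never does
  arithmetic. The descent by \<open>q * p\<close> presupposes a positive period on the right.
  Without one the right set is the single number \<open>c'\<close>, and the elements
  \<open>c\<close> and \<open>c + p\<close> of the left set decide the matter; this is a second
  demand on the bound. One upward pass per period is enough, because a mark set during the pass lies
  ahead of the scan and is met again in the same pass. Cutting the sets off at the bound loses
  nothing below it, since adding a period never leads downwards. A pass visits \<open>N * N\<close>
  cells at a cost linear in \<open>N\<close> each, and there are at most \<open>N\<close> periods,
  whence a running time of order \<open>N^4\<close>.\<close>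

lemma linear_set_empty [simp]: "linear_set c {} = {c}"
  by (simp add: linear_set_def)

text \<open>Coefficients of the same period add up, so the equation also holds when \<open>p\<close>
  already lies in \<open>P\<close>. Lists of periods with repetitions lead to this case.\<close>

lemma linear_set_insert:
  assumes "finite P"
  shows "linear_set c (insert p P) = {m + a * p | m a. m \<in> linear_set c P}"
proof (intro set_eqI iffI)
  fix n assume "n \<in> linear_set c (insert p P)"
  then obtain a where n: "n = c + (\<Sum>q\<in>insert p P. a q * q)"
    by (auto simp: linear_set_def)
  have "(\<Sum>q\<in>insert p P. a q * q) = (\<Sum>q\<in>P - {p}. a q * q) + a p * p"
    using assms by (simp add: sum.insert_remove)
  moreover have "(\<Sum>q\<in>P - {p}. a q * q) = (\<Sum>q\<in>P. (a(p := 0)) q * q)"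
    using assms by (intro sum.mono_neutral_cong_left) auto
  moreover have "c + (\<Sum>q\<in>P. (a(p := 0)) q * q) \<in> linear_set c P"
    unfolding linear_set_def by blast
  ultimately show "n \<in> {m + a * p | m a. m \<in> linear_set c P}"
    using n by (metis (mono_tags, lifting) add.assoc mem_Collect_eq)
next
  fix n assume "n \<in> {m + a * p | m a. m \<in> linear_set c P}"
  then obtain a b where n: "n = c + (\<Sum>q\<in>P. a q * q) + b * p"
    by (auto simp: linear_set_def)
  define a' where "a' = a(p := (if p \<in> P then a p else 0) + b)"
  have "(\<Sum>q\<in>insert p P. a' q * q) = a' p * p + (\<Sum>q\<in>P - {p}. a' q * q)"
    using assms by (simp add: sum.insert_remove)
  also have "(\<Sum>q\<in>P - {p}. a' q * q) = (\<Sum>q\<in>P - {p}. a q * q)"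
    by (intro sum.cong) (auto simp: a'_def)
  also have "a' p * p + (\<Sum>q\<in>P - {p}. a q * q) = (\<Sum>q\<in>P. a q * q) + b * p"
    using assms by (cases "p \<in> P") (auto simp: a'_def sum.remove algebra_simps)
  finally have "n = c + (\<Sum>q\<in>insert p P. a' q * q)"
    using n by (simp add: add.assoc)
  then show "n \<in> linear_set c (insert p P)"
    unfolding linear_set_def by blast
qed

lemma linear_set_add_multiple:
  assumes "finite P" "p \<in> P" "n \<in> linear_set c P"
  shows "n + a * p \<in> linear_set c P"
  using linear_set_insert[of P c p] assms by (auto simp: insert_absorb)

lemma base_in_linear_set: "c \<in> linear_set c P"
  unfolding linear_set_def by (rule CollectI, rule exI[of _ "\<lambda>_. 0"]) simp

lemma linear_set_subset_by_bound:
  assumes fin: "finite P" "finite P'"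
    and B: "c + \<Sum>P < B" "\<And>q. q \<in> P' \<Longrightarrow> c + q * \<Sum>P < B"
    and below: "\<And>n. n < B \<Longrightarrow> n \<in> linear_set c P \<Longrightarrow> n \<in> linear_set c' P'"
  shows "linear_set c P \<subseteq> linear_set c' P'"
proof (cases "\<exists>q\<in>P'. 0 < q")
  case True
  then obtain q where q: "q \<in> P'" "0 < q" by blast
  have "n \<in> linear_set c' P'" if "n \<in> linear_set c P" for n
    using that
  proof (induction n rule: less_induct)
    case (less n)
    then obtain a where n: "n = c + (\<Sum>p\<in>P. a p * p)"
      by (auto simp: linear_set_def)
    show ?case
    proof (cases "\<exists>p\<in>P. 0 < p \<and> q \<le> a p")
      case True
      then obtain p where p: "p \<in> P" "0 < p" "q \<le> a p" by blast
      define m where "m = c + (\<Sum>r\<in>P. (a(p := a p - q)) r * r)"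
      have "(\<Sum>r\<in>P. a r * r) = a p * p + (\<Sum>r\<in>P - {p}. a r * r)"
        using fin p by (simp add: sum.remove)
      moreover have "(\<Sum>r\<in>P. (a(p := a p - q)) r * r) = (a p - q) * p + (\<Sum>r\<in>P - {p}. a r * r)"
        using fin p by (simp add: sum.remove)
      moreover have "a p * p = (a p - q) * p + p * q"
        using p(3) by (metis add.commute add_mult_distrib le_add_diff_inverse mult.commute)
      ultimately have m: "n = m + p * q"
        by (simp add: n m_def)
      have "m \<in> linear_set c P"
        unfolding m_def linear_set_def by blast
      then have "m \<in> linear_set c' P'"
        using less.IH m p q by simp
      then show ?thesis
        using linear_set_add_multiple[OF fin(2) q(1)] m by blast
    next
      case False
      \<comment> \<open>Only positive periods are known to have a coefficient below
        \<open>q\<close>; the period 0 contributes 0 on both sides. Positivity is what made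
        \<open>m\<close> smaller than \<open>n\<close> in the other case.\<close>
      then have "(\<Sum>p\<in>P. a p * p) \<le> (\<Sum>p\<in>P. q * p)"
        by (intro sum_mono) (metis le_cases mult_0_right mult_le_mono1 neq0_conv)
      then have "n < B"
        using B(2)[OF q(1)] n by (simp add: sum_distrib_left)
      then show ?thesis
        using below less.prems by blast
    qed
  qed
  then show ?thesis by blast
next
  case False
  \<comment> \<open>The right set shrinks to \<open>c'\<close>. By \<open>B(1)\<close>,
    \<open>c\<close> and every \<open>c + p\<close> lie below \<open>B\<close>, which forces
    \<open>c = c'\<close> and \<open>p = 0\<close>.\<close>
  then have "(\<Sum>q\<in>P'. a q * q) = 0" for a :: "nat \<Rightarrow> nat"
    by (intro sum.neutral) auto
  then have L': "linear_set c' P' = {c'}"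
    by (auto simp: linear_set_def)
  have "c = c'"
    using below[of c] B(1) base_in_linear_set[of c P] L' by simp
  moreover have "p = 0" if "p \<in> P" for p
  proof -
    have "p \<le> \<Sum>P"
      using that fin(1) member_le_sum[of p P "\<lambda>x. x"] by simp
    moreover have "c + 1 * p \<in> linear_set c P"
      using that fin(1) base_in_linear_set linear_set_add_multiple by blast
    ultimately show ?thesis
      using below[of "c + p"] B(1) L' \<open>c = c'\<close> by simp
  qed
  then have "(\<Sum>q\<in>P. a q * q) = 0" for a :: "nat \<Rightarrow> nat"
    by (intro sum.neutral) auto
  ultimately show ?thesis
    using L' by (auto simp: linear_set_def)
qed

section \<open>Sieving a set by one period\<close>

fun sieve :: "nat \<Rightarrow> nat set \<Rightarrow> nat \<Rightarrow> nat set" where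
  "sieve p A 0 = A"
| "sieve p A (Suc k) =
     (if k \<in> sieve p A k then insert (k + p) (sieve p A k) else sieve p A k)"

lemma sieve_mono: "k \<le> l \<Longrightarrow> sieve p A k \<subseteq> sieve p A l"
  by (rule lift_Suc_mono_le[of "sieve p A"]) auto

text \<open>Step \<open>l\<close> can only insert \<open>l + p\<close>, which is at least
  \<open>l\<close>, and for \<open>p = 0\<close> only what is already present. So once the scan has
  reached \<open>n\<close>, membership of \<open>n\<close> is final.\<close>

lemma sieve_settled: "n \<in> sieve p A k \<Longrightarrow> n < k \<Longrightarrow> n \<in> sieve p A n"
  by (induction k) (auto simp: less_Suc_eq split: if_splits)

lemma sieve_sound: "n \<in> sieve p A k \<Longrightarrow> \<exists>m\<in>A. \<exists>a. n = m + a * p"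
proof (induction k arbitrary: n)
  case 0
  then show ?case by (intro bexI[of _ n] exI[of _ 0]) auto
next
  case (Suc k)
  show ?case
  proof (cases "n \<in> sieve p A k")
    case False
    with Suc.prems have "k \<in> sieve p A k" "n = k + p"
      by (auto split: if_splits)
    with Suc.IH obtain m a where "m \<in> A" "n = m + Suc a * p"
      by fastforce
    then show ?thesis by blast
  qed (use Suc.IH in blast)
qed

text \<open>By \<open>sieve_settled\<close> the mark on \<open>m + a * p\<close> is there when the
  scan arrives, so the same pass carries it on to the next multiple.\<close>

lemma sieve_complete: "m \<in> A \<Longrightarrow> m + a * p < k \<Longrightarrow> m + a * p \<in> sieve p A k"
proof (induction a)
  case 0
  then show ?case using sieve_mono[of 0 k p A] by auto
next
  case (Suc a)
  let ?n = "m + a * p"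
  have "?n < k" using Suc.prems by simp
  then have "?n \<in> sieve p A ?n"
    using Suc sieve_settled by blast
  then have "?n + p \<in> sieve p A (Suc ?n)" by simp
  then show ?case
    using sieve_mono[of "Suc ?n" k p A] \<open>?n < k\<close> by (auto simp: algebra_simps)
qed

lemma sieve_iff: "n < k \<Longrightarrow> n \<in> sieve p A k \<longleftrightarrow> (\<exists>m\<in>A. \<exists>a. n = m + a * p)"
  using sieve_sound sieve_complete by blast


section \<open>Syntax of instances\<close>

text \<open>A finite automaton. \<open>e = False\<close> covers both the start of a half and the
  inside of a number: in either case a comma is still due.\<close>

fun well_formed :: "bool \<Rightarrow> bool \<Rightarrow> usym list \<Rightarrow> bool" where
  "well_formed s e [] \<longleftrightarrow> s \<and> e"
| "well_formed s e (One # w) \<longleftrightarrow> well_formed s False w"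
| "well_formed s e (Comma # w) \<longleftrightarrow> well_formed s True w"
| "well_formed s e (Semicolon # w) \<longleftrightarrow> \<not> s \<and> e \<and> well_formed True False w"

lemma One_unary: "One # unary n @ w = unary (Suc n) @ w"
  by (simp add: unary_def)

lemma Comma_unary: "Comma # w = unary 0 @ w"
  by (simp add: unary_def)

lemma well_formed_unary [simp]: "well_formed s e (unary n @ w) \<longleftrightarrow> well_formed s True w"
  by (induction n arbitrary: e) (simp_all flip: One_unary Comma_unary)

lemma well_formed_unaries [simp]:
  "well_formed s True (concat (map unary ps) @ w) \<longleftrightarrow> well_formed s True w"
  by (induction ps) simp_all

text \<open>Describes the suffixes accepted from each state behind the semicolon. With
  \<open>e\<close> false the suffix begins with the rest of a pending number, which again looks like
  a unary number, followed by complete ones.\<close>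

lemma well_formed_last:
  "well_formed True e w \<Longrightarrow>
     if e then \<exists>ps. w = concat (map unary ps) else \<exists>c ps. w = encode_linear c ps"
proof (induction True e w rule: well_formed.induct)
  case (2 e w)
  then obtain c ps where "w = encode_linear c ps" by auto
  then have "One # w = encode_linear (Suc c) ps" "One # w = concat (map unary (Suc c # ps))"
    by (simp_all add: encode_linear_def One_unary)
  then show ?case by (metis (full_types))
next
  case (3 e w)
  then obtain ps where "w = concat (map unary ps)" by auto
  then have "Comma # w = encode_linear 0 ps" "Comma # w = concat (map unary (0 # ps))"
    by (simp_all add: encode_linear_def Comma_unary)
  then show ?case by (metis (full_types))
qed (auto intro: exI[of _ "[]"])

lemma well_formed_first:
  "well_formed False e w \<Longrightarrow>
     if e then \<exists>ps d qs. w = concat (map unary ps) @ Semicolon # encode_linear d qs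
     else \<exists>c ps d qs. w = encode_linear c ps @ Semicolon # encode_linear d qs"
proof (induction False e w rule: well_formed.induct)
  case (2 e w)
  then obtain c ps d qs where "w = encode_linear c ps @ Semicolon # encode_linear d qs" by auto
  then have "One # w = encode_linear (Suc c) ps @ Semicolon # encode_linear d qs"
    "One # w = concat (map unary (Suc c # ps)) @ Semicolon # encode_linear d qs"
    by (simp_all add: encode_linear_def[of c] encode_linear_def[of "Suc c"] One_unary)
  then show ?case by (metis (full_types))
next
  case (3 e w)
  then obtain ps d qs where "w = concat (map unary ps) @ Semicolon # encode_linear d qs" by auto
  then have "Comma # w = encode_linear 0 ps @ Semicolon # encode_linear d qs"
    "Comma # w = concat (map unary (0 # ps)) @ Semicolon # encode_linear d qs"
    by (simp_all add: encode_linear_def[of 0] Comma_unary)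
  then show ?case by (metis (full_types))
next
  case (4 e w)
  then have e by simp
  moreover obtain d qs where "w = encode_linear d qs"
    using 4 well_formed_last[of False w] by auto
  moreover have "Semicolon # w = concat (map unary []) @ Semicolon # w" by simp
  ultimately show ?case by metis
qed auto

lemma well_formed_iff_encode_pair:
  "well_formed False False w \<longleftrightarrow> (\<exists>c ps d qs. w = encode_pair c ps d qs)"
proof
  assume "well_formed False False w"
  from well_formed_first[OF this] show "\<exists>c ps d qs. w = encode_pair c ps d qs"
    by (simp add: encode_pair_def)
next
  have "well_formed True True (concat (map unary qs))" for qs
    using well_formed_unaries[of True qs "[]"] by simp
  then show "well_formed False False w" if "\<exists>c ps d qs. w = encode_pair c ps d qs"
    using that by (auto simp: encode_pair_def encode_linear_def)
qed


section \<open>The machine\<close>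

type_synonym sym = "usym tsym"

text \<open>
  The third tape holds \<open>N\<^sup>2\<close> cells \<open>Work m\<close>, where \<open>N\<close> is the length of the input; the low
  and the high bit of \<open>m < 4\<close> record membership in the left and in the right linear set. The
  second tape only serves to count to \<open>N\<close>. In \<open>Scan s e\<close>, the flag \<open>s\<close> says that the semicolon has
  been read, and \<open>e\<close> that the last symbol is a comma.
\<close>

datatype st = Scan bool bool | Row | Fill | Rewind | Add bool | Back bool | Skip bool
  | Next bool | Sieve bool | Fwd bool | Bwd bool | Check | Acc | Rej

instance st :: countable
  by countable_datatype

instance st :: finite
proof
  let ?S = "(\<Union>s e. {Scan s e}) \<union> {Row, Fill, Rewind, Check, Acc, Rej}
    \<union> (\<Union>b. {Add b, Back b, Skip b, Next b, Sieve b, Fwd b, Bwd b})"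
  have "q \<in> ?S" for q :: st
    by (cases q) auto
  then have "UNIV \<subseteq> ?S" by blast
  moreover have "finite ?S" by simp
  ultimately show "finite (UNIV :: st set)"
    by (rule finite_subset)
qed

fun marked :: "bool \<Rightarrow> sym \<Rightarrow> bool" where
  "marked b (Work m) = (if b then 2 \<le> m else odd m)"
| "marked b _ = False"

fun mark :: "bool \<Rightarrow> sym \<Rightarrow> sym" where
  "mark b (Work m) = Work (if marked b (Work m) then m else if b then m + 2 else m + 1)"
| "mark b s = s"

type_synonym action = "st \<times> direction \<times> (sym \<times> direction) \<times> (sym \<times> direction)"

text \<open>Nothing is ever written on the input tape. \<open>Back\<close> and \<open>Skip\<close>
  serve every return to the start of the map; \<open>Skip\<close> meets a blank only to the left of
  the input, just after the map has been laid out, and then the left base is due.\<close>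

fun nxt :: "st \<Rightarrow> sym \<Rightarrow> sym \<Rightarrow> sym \<Rightarrow> action" where
  "nxt (Scan s e) x y z =
     (case x of
        Inp One \<Rightarrow> (Scan s False, Rgt, (Work 0, Rgt), (z, Stay))
      | Inp Comma \<Rightarrow> (Scan s True, Rgt, (Work 0, Rgt), (z, Stay))
      | Inp Semicolon \<Rightarrow>
          if \<not> s \<and> e then (Scan True False, Rgt, (Work 0, Rgt), (z, Stay))
          else (Rej, Stay, (y, Stay), (z, Stay))
      | _ \<Rightarrow>
          if s \<and> e then (Row, Lft, (y, Lft), (z, Stay))
          else (Rej, Stay, (y, Stay), (z, Stay)))"
| "nxt Row x y z =
     (if x = Blank then (Back False, Stay, (y, Stay), (z, Lft))
      else (Fill, Stay, (y, Stay), (z, Stay)))"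
| "nxt Fill x y z =
     (if y = Blank then (Rewind, Stay, (y, Rgt), (z, Stay))
      else (Fill, Stay, (y, Lft), (Work 0, Rgt)))"
| "nxt Rewind x y z =
     (if y = Blank then (Row, Lft, (y, Lft), (z, Stay))
      else (Rewind, Stay, (y, Rgt), (z, Stay)))"
| "nxt (Back b) x y z =
     (if z = Blank then (Skip b, Stay, (y, Stay), (z, Rgt))
      else (Back b, Stay, (y, Stay), (z, Lft)))"
| "nxt (Skip b) x y z =
     (if x = Inp One then Skip b else if x = Blank then Add False else Next b,
      Rgt, (y, Stay), (z, Stay))"
| "nxt (Add b) x y z =
     (if x = Inp One then (Add b, Rgt, (y, Stay), (z, Rgt))
      else (Back b, Stay, (y, Stay), (mark b z, Stay)))"
| "nxt (Next b) x y z =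
     (if x = Blank then (Check, Stay, (y, Stay), (z, Stay))
      else if x = Inp Semicolon then (Add True, Rgt, (y, Stay), (z, Stay))
      else (Sieve b, Stay, (y, Stay), (z, Stay)))"
| "nxt (Sieve b) x y z =
     (if z = Blank then (Back b, Stay, (y, Stay), (z, Lft))
      else if marked b z then (Fwd b, Stay, (y, Stay), (z, Stay))
      else (Sieve b, Stay, (y, Stay), (z, Rgt)))"
| "nxt (Fwd b) x y z =
     (if x = Inp One then (Fwd b, Rgt, (y, Stay), (z, Rgt))
      else (Bwd b, Lft, (y, Stay), (mark b z, Stay)))"
| "nxt (Bwd b) x y z =
     (if x = Inp One then (Bwd b, Lft, (y, Stay), (z, Lft))
      else (Sieve b, Rgt, (y, Stay), (z, Rgt)))"
| "nxt Check x y z =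
     (if z = Blank then (Acc, Stay, (y, Stay), (z, Stay))
      else if marked False z \<and> \<not> marked True z then (Rej, Stay, (y, Stay), (z, Stay))
      else (Check, Stay, (y, Stay), (z, Rgt)))"
| "nxt Acc x y z = (Acc, Stay, (y, Stay), (z, Stay))"
| "nxt Rej x y z = (Rej, Stay, (y, Stay), (z, Stay))"

type_synonym cfg =
  "st \<times> (int \<Rightarrow> sym) \<times> int \<times> (int \<Rightarrow> sym) \<times> int \<times> (int \<Rightarrow> sym) \<times> int"

fun step :: "cfg \<Rightarrow> cfg" where
  "step (q, f, i, g, j, h, k) =
     (case nxt q (f i) (g j) (h k) of (q', d, (y, d'), (z, d'')) \<Rightarrow>
        (q', f, i + head_offset d, g(j := y), j + head_offset d', h(k := z), k + head_offset d''))"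

text \<open>Time is an upper bound, so that estimates can be rounded at any point of a run.\<close>

definition reach :: "nat \<Rightarrow> cfg \<Rightarrow> cfg \<Rightarrow> bool" where
  "reach T C D \<longleftrightarrow> (\<exists>n\<le>T. (step ^^ n) C = D)"

lemma reach_refl: "reach T C C"
  unfolding reach_def by (rule exI[of _ 0]) simp

lemma reach_step: "step C = D \<Longrightarrow> reach 1 C D"
  unfolding reach_def by (rule exI[of _ 1]) simp

lemma reach_mono: "reach S C D \<Longrightarrow> S \<le> T \<Longrightarrow> reach T C D"
  unfolding reach_def using le_trans by blast

lemma reach_trans [trans]:
  assumes "reach S C D" "reach T D E"
  shows "reach (S + T) C E"
proof -
  obtain m n where "m \<le> S" "(step ^^ m) C = D" "n \<le> T" "(step ^^ n) D = E"
    using assms by (auto simp: reach_def)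
  then have "n + m \<le> S + T" "(step ^^ (n + m)) C = E"
    by (simp_all add: funpow_add)
  then show ?thesis unfolding reach_def by blast
qed

text \<open>One induction for all loops on a single state that leave the tapes as they are.\<close>

lemma reach_sweep:
  assumes "\<And>m. m < n \<Longrightarrow>
    nxt q (f (i + int m * head_offset d)) (g (j + int m * head_offset d'))
      (h (k + int m * head_offset d''))
    = (q, d, (g (j + int m * head_offset d'), d'), (h (k + int m * head_offset d''), d''))"
  shows "reach n (q, f, i, g, j, h, k)
    (q, f, i + int n * head_offset d, g, j + int n * head_offset d', h, k + int n * head_offset d'')"
  using assms
proof (induction n)
  case 0
  show ?case by (simp add: reach_refl)
next
  case (Suc n)
  have "reach n (q, f, i, g, j, h, k)
    (q, f, i + int n * head_offset d, g, j + int n * head_offset d', h, k + int n * head_offset d'')"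
    using Suc by simp
  also have "reach 1 \<dots> (q, f, i + int (Suc n) * head_offset d, g, j + int (Suc n) * head_offset d',
      h, k + int (Suc n) * head_offset d'')"
    by (rule reach_step) (simp add: Suc.prems[OF lessI], simp add: algebra_simps)
  finally show ?case by simp
qed


section \<open>Tape contents\<close>

definition inp :: "usym list \<Rightarrow> int \<Rightarrow> sym" where
  "inp w = fst (input_tape w)"

lemma inp_append_nth [simp]:
  "0 \<le> k \<Longrightarrow> inp (u @ v) (int (length u) + k) = inp v k"
  by (auto simp: inp_def input_tape_def nth_append nat_add_distrib)

lemma inp_Cons [simp]: "inp (x # v) 0 = Inp x"
  by (simp add: inp_def input_tape_def)

lemma inp_outside: "k < 0 \<or> int (length w) \<le> k \<Longrightarrow> inp w k = Blank"
  by (auto simp: inp_def input_tape_def)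

lemma inp_inside: "0 \<le> k \<Longrightarrow> k < int (length w) \<Longrightarrow> inp w k \<noteq> Blank"
  by (auto simp: inp_def input_tape_def)

lemma inp_unary_One: "m < n \<Longrightarrow> inp (u @ unary n @ v) (int (length u) + int m) = Inp One"
  by simp (simp add: inp_def input_tape_def unary_def nth_append)

lemma inp_unary_Comma: "inp (u @ unary n @ v) (int (length u) + int n) = Inp Comma"
  by simp (simp add: inp_def input_tape_def unary_def nth_append)

text \<open>The sets may be infinite: only their part below \<open>B\<close> shows on the tape, so
  linear sets need no explicit truncation. With empty sets the same function describes the counter
  on the second tape and the partly built map.\<close>

definition cells :: "nat \<Rightarrow> (bool \<Rightarrow> nat set) \<Rightarrow> int \<Rightarrow> sym" where
  "cells B A k =
     (if 0 \<le> k \<and> k < int B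
      then Work (of_bool (nat k \<in> A False) + 2 * of_bool (nat k \<in> A True)) else Blank)"

lemma cells_eq_Blank_iff: "cells B A k = Blank \<longleftrightarrow> k < 0 \<or> int B \<le> k"
  by (auto simp: cells_def)

lemma marked_cells: "n < B \<Longrightarrow> marked b (cells B A (int n)) \<longleftrightarrow> n \<in> A b"
  by (cases b) (auto simp: cells_def)

text \<open>\<open>n\<close> may lie beyond the map: the cell there is blank, \<open>mark\<close>
  leaves it blank, and the inserted number does not show.\<close>

lemma mark_cells:
  "(cells B A)(int n := mark b (cells B A (int n))) = cells B (A(b := insert n (A b)))"
  by (rule ext, cases b) (auto simp: cells_def)

lemma cells_extend: "(cells n (\<lambda>_. {}))(int n := Work 0) = cells (Suc n) (\<lambda>_. {})"
  by (rule ext) (auto simp: cells_def)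

lemma cells_0: "cells 0 A = (\<lambda>_. Blank)"
  by (rule ext) (simp add: cells_def)

lemma cells_cong: "(\<And>b n. n < B \<Longrightarrow> n \<in> A b \<longleftrightarrow> n \<in> A' b) \<Longrightarrow> cells B A = cells B A'"
  by (rule ext) (auto simp: cells_def)


section \<open>Runs of the machine\<close>

text \<open>\<open>Scan\<close> runs the automaton \<open>well_formed\<close> and lays one counter
  cell per symbol. The rejecting configuration stays unspecified, as only its state matters.\<close>

lemma reach_scan:
  "w = u @ v \<Longrightarrow> \<exists>C. reach (Suc (length v))
       (Scan s e, inp w, int (length u), cells (length u) (\<lambda>_. {}), int (length u), h, k) C \<and>
     (if well_formed s e v
      then C = (Row, inp w, int (length w) - 1, cells (length w) (\<lambda>_. {}), int (length w) - 1, h, k)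
      else fst C = Rej)"
proof (induction s e v arbitrary: u rule: well_formed.induct)
  case (1 s e)
  then have "inp w (int (length u)) = Blank" by (simp add: inp_outside)
  then show ?case using 1
    by (intro exI[of _ "step
        (Scan s e, inp w, int (length u), cells (length u) (\<lambda>_. {}), int (length u), h, k)"])
      (auto intro: reach_mono[OF reach_step])
next
  case (2 s e v)
  have "inp w (int (length u)) = Inp One"
    using 2(2) inp_append_nth[of 0 u "One # v"] by simp
  then have "reach 1
      (Scan s e, inp w, int (length u), cells (length u) (\<lambda>_. {}), int (length u), h, k)
      (Scan s False, inp w, int (length (u @ [One])), cells (length (u @ [One])) (\<lambda>_. {}),
        int (length (u @ [One])), h, k)"
    by (intro reach_step) (simp add: cells_extend)
  then show ?case using 2(1)[of "u @ [One]"] 2(2) reach_trans[of 1] by fastforce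
next
  case (3 s e v)
  have "inp w (int (length u)) = Inp Comma"
    using 3(2) inp_append_nth[of 0 u "Comma # v"] by simp
  then have "reach 1
      (Scan s e, inp w, int (length u), cells (length u) (\<lambda>_. {}), int (length u), h, k)
      (Scan s True, inp w, int (length (u @ [Comma])), cells (length (u @ [Comma])) (\<lambda>_. {}),
        int (length (u @ [Comma])), h, k)"
    by (intro reach_step) (simp add: cells_extend)
  then show ?case using 3(1)[of "u @ [Comma]"] 3(2) reach_trans[of 1] by fastforce
next
  case (4 s e v)
  have x: "inp w (int (length u)) = Inp Semicolon"
    using 4(2) inp_append_nth[of 0 u "Semicolon # v"] by simp
  show ?case
  proof (cases "\<not> s \<and> e")
    case True
    with x have "reach 1
      (Scan s e, inp w, int (length u), cells (length u) (\<lambda>_. {}), int (length u), h, k)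
        (Scan True False, inp w, int (length (u @ [Semicolon])), cells (length (u @ [Semicolon])) (\<lambda>_. {}),
        int (length (u @ [Semicolon])), h, k)"
      by (intro reach_step) (simp add: cells_extend)
    then show ?thesis using 4(1)[of "u @ [Semicolon]"] 4(2) True reach_trans[of 1] by fastforce
  next
    case False
    then show ?thesis using x
      by (intro exI[of _ "step
        (Scan s e, inp w, int (length u), cells (length u) (\<lambda>_. {}), int (length u), h, k)"])
        (auto intro: reach_mono[OF reach_step])
  qed
qed

section \<open>Laying out the map, one row of \<open>N\<close> cells per input symbol\<close>

lemma reach_fill:
  "n \<le> N \<Longrightarrow> reach n (Fill, f, i, cells N A, int n - 1, cells z (\<lambda>_. {}), int z)
     (Fill, f, i, cells N A, -1, cells (z + n) (\<lambda>_. {}), int (z + n))"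
proof (induction n arbitrary: z)
  case 0
  show ?case by (simp add: reach_refl)
next
  case (Suc n)
  have "reach 1 (Fill, f, i, cells N A, int (Suc n) - 1, cells z (\<lambda>_. {}), int z)
      (Fill, f, i, cells N A, int n - 1, cells (Suc z) (\<lambda>_. {}), int (Suc z))"
    using Suc.prems by (intro reach_step) (simp add: cells_eq_Blank_iff cells_extend)
  also have "reach n \<dots> (Fill, f, i, cells N A, -1, cells (Suc z + n) (\<lambda>_. {}), int (Suc z + n))"
    using Suc.prems by (intro Suc.IH) simp
  finally show ?case by simp
qed

lemma reach_row:
  assumes "f i \<noteq> Blank"
  shows "reach (2 * N + 3) (Row, f, i, cells N A, int N - 1, cells z (\<lambda>_. {}), int z)
    (Row, f, i - 1, cells N A, int N - 1, cells (z + N) (\<lambda>_. {}), int (z + N))"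
proof -
  let ?h = "cells (z + N) (\<lambda>_. {})" and ?k = "int (z + N)"
  have "reach 1 (Row, f, i, cells N A, int N - 1, cells z (\<lambda>_. {}), int z)
      (Fill, f, i, cells N A, int N - 1, cells z (\<lambda>_. {}), int z)"
    using assms by (intro reach_step) simp
  also have "reach N \<dots> (Fill, f, i, cells N A, -1, ?h, ?k)"
    using reach_fill by simp
  also have "reach 1 \<dots> (Rewind, f, i, cells N A, 0, ?h, ?k)"
    by (intro reach_step) (simp add: cells_eq_Blank_iff)
  also have "reach N \<dots> (Rewind, f, i, cells N A, int N, ?h, ?k)"
    using reach_sweep[of N Rewind f i Stay "cells N A" 0 Rgt ?h ?k Stay]
    by (simp add: cells_eq_Blank_iff)
  also have "reach 1 \<dots> (Row, f, i - 1, cells N A, int N - 1, ?h, ?k)"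
    by (intro reach_step) (simp add: cells_eq_Blank_iff)
  finally show ?thesis
    by (rule reach_mono) simp
qed

text \<open>The input, read from right to left, is the outer counter. Its head ends at -1, on the
  blank from which \<open>Skip\<close> later enters the left base.\<close>

lemma reach_rows:
  assumes "\<And>i. 0 \<le> i \<Longrightarrow> i < int m \<Longrightarrow> f i \<noteq> Blank"
  shows "reach (m * (2 * N + 3)) (Row, f, int m - 1, cells N A, int N - 1, cells z (\<lambda>_. {}), int z)
    (Row, f, -1, cells N A, int N - 1, cells (z + m * N) (\<lambda>_. {}), int (z + m * N))"
  using assms
proof (induction m arbitrary: z)
  case 0
  show ?case by (simp add: reach_refl)
next
  case (Suc m)
  have "reach (2 * N + 3) (Row, f, int (Suc m) - 1, cells N A, int N - 1, cells z (\<lambda>_. {}), int z)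
      (Row, f, int m - 1, cells N A, int N - 1, cells (z + N) (\<lambda>_. {}), int (z + N))"
    using reach_row[of f "int m"] Suc.prems by simp
  also have "reach (m * (2 * N + 3)) \<dots>
      (Row, f, -1, cells N A, int N - 1, cells (z + N + m * N) (\<lambda>_. {}), int (z + N + m * N))"
    using Suc.prems by (intro Suc.IH) simp
  finally show ?case by (simp add: algebra_simps)
qed

section \<open>Entering a base and sieving by a period\<close>

lemma reach_back:
  assumes "n \<le> B"
  shows "reach (Suc n) (Back b, f, i, g, j, cells B A, int n - 1) (Skip b, f, i, g, j, cells B A, 0)"
proof -
  have "reach n (Back b, f, i, g, j, cells B A, int n - 1) (Back b, f, i, g, j, cells B A, -1)"
    using reach_sweep[of n "Back b" f i Stay g j Stay "cells B A" "int n - 1" Lft] assms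
    by (simp add: cells_eq_Blank_iff)
  also have "reach 1 \<dots> (Skip b, f, i, g, j, cells B A, 0)"
    by (intro reach_step) (simp add: cells_eq_Blank_iff)
  finally show ?thesis by simp
qed

lemma reach_skip:
  assumes "\<And>m. m < p \<Longrightarrow> f (i + int m) = Inp One" "f (i + int p) = Inp Comma"
  shows "reach (Suc p) (Skip b, f, i, g, j, h, k) (Next b, f, i + int p + 1, g, j, h, k)"
proof -
  have "reach p (Skip b, f, i, g, j, h, k) (Skip b, f, i + int p, g, j, h, k)"
    using reach_sweep[of p "Skip b" f i Rgt g j Stay h k Stay] assms by simp
  also have "reach 1 \<dots> (Next b, f, i + int p + 1, g, j, h, k)"
    using assms by (intro reach_step) simp
  finally show ?thesis by simp
qed

lemma reach_add:
  assumes "\<And>m. m < c \<Longrightarrow> f (i + int m) = Inp One" "f (i + int c) = Inp Comma"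
    and "c < B" "A b = {}"
  shows "reach (2 * B + 4) (Add b, f, i, g, j, cells B A, 0)
    (Next b, f, i + int c + 1, g, j, cells B (A(b := {c})), 0)"
proof -
  have "reach c (Add b, f, i, g, j, cells B A, 0) (Add b, f, i + int c, g, j, cells B A, int c)"
    using reach_sweep[of c "Add b" f i Rgt g j Stay "cells B A" 0 Rgt] assms by simp
  \<comment> \<open>The map head is on cell \<open>c\<close>, written in the form that
    \<open>reach_back\<close> expects. The input head rests on the comma, so \<open>Skip\<close>
    moves on at once.\<close>
  also have "reach 1 \<dots> (Back b, f, i + int c, g, j, cells B (A(b := {c})), int (Suc c) - 1)"
    using assms mark_cells[of B A c b] by (intro reach_step) simp
  also have "reach (Suc (Suc c)) \<dots> (Skip b, f, i + int c, g, j, cells B (A(b := {c})), 0)"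
    using assms by (intro reach_back) simp
  also have "reach 1 \<dots> (Next b, f, i + int c + 1, g, j, cells B (A(b := {c})), 0)"
    using assms by (intro reach_step) simp
  finally show ?thesis
    by (rule reach_mono) (use assms in simp)
qed

text \<open>The symbol before the block of ones stops the way back. Entering \<open>Bwd\<close>
  moves the input head alone, so at the stop it is on \<open>i - 1\<close> while the map head is on
  \<open>n\<close>; one joint move to the right then restores the former and advances the
  latter.\<close>

lemma reach_shifted_mark:
  assumes "\<And>m. m < p \<Longrightarrow> f (i + int m) = Inp One" "f (i + int p) = Inp Comma"
    and "f (i - 1) \<noteq> Inp One"
  shows "reach (2 * p + 2) (Fwd b, f, i, g, j, cells B A, int n)
    (Sieve b, f, i, g, j, cells B (A(b := insert (n + p) (A b))), int (Suc n))"
proof -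
  let ?h = "cells B (A(b := insert (n + p) (A b)))"
  have "reach p (Fwd b, f, i, g, j, cells B A, int n)
      (Fwd b, f, i + int p, g, j, cells B A, int (n + p))"
    using reach_sweep[of p "Fwd b" f i Rgt g j Stay "cells B A" "int n" Rgt] assms by simp
  also have "reach 1 \<dots> (Bwd b, f, i + int p - 1, g, j, ?h, int (n + p))"
    using assms mark_cells[of B A "n + p" b] by (intro reach_step) simp
  also have "reach p \<dots> (Bwd b, f, i - 1, g, j, ?h, int n)"
  proof -
    have "f (i + int p - 1 - int m) = Inp One" if "m < p" for m
      using assms(1)[of "p - Suc m"] that by (simp add: algebra_simps of_nat_diff)
    then show ?thesis
      using reach_sweep[of p "Bwd b" f "i + int p - 1" Lft g j Stay ?h "int (n + p)" Lft] by simp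
  qed
  also have "reach 1 \<dots> (Sieve b, f, i, g, j, ?h, int (Suc n))"
    using assms by (intro reach_step) simp
  finally show ?thesis
    by (rule reach_mono) simp
qed

lemma reach_sieve:
  assumes "\<And>m. m < p \<Longrightarrow> f (i + int m) = Inp One" "f (i + int p) = Inp Comma"
    and "f (i - 1) \<noteq> Inp One"
  shows "n \<le> B \<Longrightarrow> reach (n * (2 * p + 3)) (Sieve b, f, i, g, j, cells B A, 0)
    (Sieve b, f, i, g, j, cells B (A(b := sieve p (A b) n)), int n)"
proof (induction n)
  case 0
  show ?case by (simp add: reach_refl)
next
  case (Suc n)
  let ?A = "A(b := sieve p (A b) n)"
  have "reach (n * (2 * p + 3)) (Sieve b, f, i, g, j, cells B A, 0)
      (Sieve b, f, i, g, j, cells B ?A, int n)"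
    using Suc.prems by (intro Suc.IH) simp
  also have "reach (2 * p + 3) \<dots>
      (Sieve b, f, i, g, j, cells B (A(b := sieve p (A b) (Suc n))), int (Suc n))"
  proof (cases "n \<in> sieve p (A b) n")
    case True
    have "reach 1 (Sieve b, f, i, g, j, cells B ?A, int n) (Fwd b, f, i, g, j, cells B ?A, int n)"
      using Suc.prems True by (intro reach_step) (simp add: cells_eq_Blank_iff marked_cells)
    also have "reach (2 * p + 2) \<dots>
        (Sieve b, f, i, g, j, cells B (?A(b := insert (n + p) (?A b))), int (Suc n))"
      using assms by (rule reach_shifted_mark)
    finally show ?thesis using True by (simp add: numeral_3_eq_3)
  next
    case False
    have "reach 1 (Sieve b, f, i, g, j, cells B ?A, int n)
        (Sieve b, f, i, g, j, cells B ?A, int (Suc n))"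
      using Suc.prems False by (intro reach_step) (simp add: cells_eq_Blank_iff marked_cells)
    then show ?thesis using False by (simp add: reach_mono)
  qed
  finally show ?case by (simp only: mult_Suc add.commute)
qed

lemma reach_period:
  assumes "\<And>m. m < p \<Longrightarrow> f (i + int m) = Inp One" "f (i + int p) = Inp Comma"
    and "f (i - 1) \<noteq> Inp One"
  shows "reach (B * (2 * p + 4) + p + 4) (Next b, f, i, g, j, cells B A, 0)
    (Next b, f, i + int p + 1, g, j, cells B (A(b := {m + a * p | m a. m \<in> A b})), 0)"
proof -
  let ?h = "cells B (A(b := sieve p (A b) B))"
  have "f i = Inp One \<or> f i = Inp Comma"
    using assms(1)[of 0] assms(2) by (cases p) auto
  then have "reach 1 (Next b, f, i, g, j, cells B A, 0) (Sieve b, f, i, g, j, cells B A, 0)"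
    by (intro reach_step) auto
  also have "reach (B * (2 * p + 3)) \<dots> (Sieve b, f, i, g, j, ?h, int B)"
    using reach_sieve assms by blast
  also have "reach 1 \<dots> (Back b, f, i, g, j, ?h, int B - 1)"
    by (intro reach_step) (simp add: cells_eq_Blank_iff)
  also have "reach (Suc B) \<dots> (Skip b, f, i, g, j, ?h, 0)"
    by (rule reach_back) simp
  also have "reach (Suc p) \<dots> (Next b, f, i + int p + 1, g, j, ?h, 0)"
    using assms by (intro reach_skip)
  \<comment> \<open>The sieve is exact only below \<open>B\<close>, and \<open>cells\<close> shows
    nothing else.\<close>
  also have "?h = cells B (A(b := {m + a * p | m a. m \<in> A b}))"
    by (rule cells_cong) (auto simp: sieve_iff)
  finally show ?thesis
    by (rule reach_mono) (simp add: algebra_simps)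
qed

text \<open>\<open>Q\<close> collects the periods already sieved, which keeps the invariant an exact
  linear set. The comma ending \<open>u\<close> is what stops \<open>Bwd\<close>.\<close>

lemma reach_periods:
  assumes "w = u @ concat (map unary ps) @ v" "u \<noteq> []" "last u = Comma"
    and "A b = linear_set c Q" "finite Q"
  shows "reach (length ps * (B * (2 * length w + 4) + length w + 4))
    (Next b, inp w, int (length u), g, j, cells B A, 0)
    (Next b, inp w, int (length (u @ concat (map unary ps))), g, j,
      cells B (A(b := linear_set c (Q \<union> set ps))), 0)"
  using assms
proof (induction ps arbitrary: u A Q)
  case Nil
  then have "A(b := linear_set c Q) = A" by (metis fun_upd_triv)
  then show ?case by (simp add: reach_refl)
next
  case (Cons p ps)
  let ?A = "A(b := linear_set c (insert p Q))"
  let ?T = "B * (2 * length w + 4) + length w + 4"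
  have w: "w = u @ unary p @ (concat (map unary ps) @ v)"
    using Cons.prems(1) by simp
  obtain u' where u': "u = u' @ [Comma]"
    using Cons.prems by (metis append_butlast_last_id)
  have "inp w (int (length u) - 1) = Inp Comma"
    using inp_append_nth[of 0 u' "Comma # unary p @ concat (map unary ps) @ v"] w u' by simp
  then have period: "reach (B * (2 * p + 4) + p + 4) (Next b, inp w, int (length u), g, j, cells B A, 0)
      (Next b, inp w, int (length u) + int p + 1, g, j,
        cells B (A(b := {m + a * p | m a. m \<in> A b})), 0)"
    using inp_unary_One inp_unary_Comma w by (intro reach_period) auto
  have insert: "{m + a * p | m a. m \<in> A b} = linear_set c (insert p Q)"
    using Cons.prems by (simp add: linear_set_insert)
  have len: "int (length u) + int p + 1 = int (length (u @ unary p))"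
    by (simp add: unary_def)
  have "p \<le> length w"
    by (simp add: w unary_def)
  then have le: "B * (2 * p + 4) + p + 4 \<le> ?T"
    by (simp add: add_mono)
  from reach_mono[OF period le]
  have "reach ?T (Next b, inp w, int (length u), g, j, cells B A, 0)
      (Next b, inp w, int (length (u @ unary p)), g, j, cells B ?A, 0)"
    unfolding insert len .
  also have "reach (length ps * ?T) \<dots>
      (Next b, inp w, int (length ((u @ unary p) @ concat (map unary ps))), g, j,
        cells B (?A(b := linear_set c (insert p Q \<union> set ps))), 0)"
    using Cons.prems by (intro Cons.IH) (simp_all add: unary_def)
  finally show ?case by (simp add: algebra_simps fun_upd_def cong: if_cong)
qed

lemma reach_linear:
  assumes "w = u @ encode_linear c ps @ v" "c < B" "A b = {}"
  shows "reach (2 * B + 4 + length ps * (B * (2 * length w + 4) + length w + 4))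
    (Add b, inp w, int (length u), g, j, cells B A, 0)
    (Next b, inp w, int (length (u @ encode_linear c ps)), g, j,
      cells B (A(b := linear_set c (set ps))), 0)"
proof -
  have w: "w = u @ unary c @ (concat (map unary ps) @ v)"
    using assms(1) by (simp add: encode_linear_def)
  have "reach (2 * B + 4) (Add b, inp w, int (length u), g, j, cells B A, 0)
      (Next b, inp w, int (length u) + int c + 1, g, j, cells B (A(b := {c})), 0)"
    using inp_unary_One inp_unary_Comma w assms by (intro reach_add) auto
  also have "int (length u) + int c + 1 = int (length (u @ unary c))"
    by (simp add: unary_def)
  also have "reach (length ps * (B * (2 * length w + 4) + length w + 4))
      (Next b, inp w, int (length (u @ unary c)), g, j, cells B (A(b := {c})), 0)
      (Next b, inp w, int (length ((u @ unary c) @ concat (map unary ps))), g, j,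
        cells B ((A(b := {c}))(b := linear_set c ({} \<union> set ps))), 0)"
    using w by (intro reach_periods) (simp_all add: unary_def)
  finally show ?thesis by (simp add: encode_linear_def)
qed

section \<open>Comparing the two sets on the map\<close>

lemma reach_check:
  assumes "\<And>m. m < n \<Longrightarrow> m \<in> A False \<Longrightarrow> m \<in> A True" "n \<le> B"
  shows "reach n (Check, f, i, g, j, cells B A, 0) (Check, f, i, g, j, cells B A, int n)"
  using reach_sweep[of n Check f i Stay g j Stay "cells B A" 0 Rgt] assms
  by (simp add: cells_eq_Blank_iff marked_cells)

lemma reach_verdict:
  "\<exists>C. reach (Suc B) (Check, f, i, g, j, cells B A, 0) C \<and>
     fst C = (if \<forall>n<B. n \<in> A False \<longrightarrow> n \<in> A True then Acc else Rej)"
proof -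
  \<comment> \<open>\<open>B\<close> is a sentinel: a least bad number always exists, and
    \<open>Check\<close> halts there, either behind the map or on a counterexample.\<close>
  define bad where "bad n \<longleftrightarrow> n = B \<or> n \<in> A False \<and> n \<notin> A True" for n
  define n where "n = (LEAST n. bad n)"
  have "bad B" by (simp add: bad_def)
  then have n: "bad n" "\<And>m. m < n \<Longrightarrow> \<not> bad m" "n \<le> B"
    unfolding n_def by (auto intro: LeastI Least_le dest: not_less_Least)
  let ?C = "step (Check, f, i, g, j, cells B A, int n)"
  have "reach n (Check, f, i, g, j, cells B A, 0) (Check, f, i, g, j, cells B A, int n)"
    using n by (intro reach_check) (auto simp: bad_def)
  also have "reach 1 \<dots> ?C"
    by (rule reach_step) simp
  finally have "reach (Suc B) (Check, f, i, g, j, cells B A, 0) ?C"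
    by (rule reach_mono) (simp add: n)
  moreover have "fst ?C = (if \<forall>n<B. n \<in> A False \<longrightarrow> n \<in> A True then Acc else Rej)"
  proof (cases "n = B")
    case True
    then show ?thesis using n by (auto simp: cells_eq_Blank_iff bad_def)
  next
    case False
    then have "n < B" using n by simp
    then show ?thesis using n \<open>n < B\<close> by (auto simp: cells_eq_Blank_iff marked_cells bad_def)
  qed
  ultimately show ?thesis by blast
qed

definition init :: "usym list \<Rightarrow> cfg" where
  "init w = (Scan False False, inp w, 0, \<lambda>_. Blank, 0, \<lambda>_. Blank, 0)"

section \<open>Running time and size of the map\<close>

definition time_poly :: "nat poly" where
  "time_poly = smult 60 ([:1, 1:] ^ 4)"

lemma poly_time_poly: "poly time_poly n = 60 * (n + 1) ^ 4"
  by (simp add: time_poly_def add.commute)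

text \<open>A period costs at most \<open>T\<close>, which is cubic in \<open>N\<close>, and the two
  halves together have at most \<open>N\<close> periods. The factor 60 is a coarse choice that
  absorbs all lower terms.\<close>

lemma time_bound:
  fixes N a :: nat
  assumes "a + b \<le> N"
  defines "T \<equiv> N * N * (2 * N + 4) + N + 4"
  shows "Suc N + N * (2 * N + 3) + 1 + Suc (N * N) + 1 + (2 * (N * N) + 4 + a * T) + 1
    + (2 * (N * N) + 4 + b * T) + 1 + Suc (N * N) \<le> 60 * (N + 1) ^ 4"
proof -
  have "a * T + b * T \<le> N * T"
    using assms(1) by (metis add_mult_distrib mult_le_mono1)
  then show ?thesis
    by (simp add: T_def power4_eq_xxxx algebra_simps)
qed

lemma decision_bound:
  assumes N: "N = length (encode_pair c ps c' ps')"
  shows "c < N * N" "c' < N * N"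
    and "(\<forall>n<N * N. n \<in> linear_set c (set ps) \<longrightarrow> n \<in> linear_set c' (set ps')) \<longleftrightarrow>
      linear_set c (set ps) \<subseteq> linear_set c' (set ps')"
proof -
  have s: "\<Sum>(set ps) \<le> sum_list ps"
    by (induction ps) (auto simp: sum.insert_if)
  \<comment> \<open>Here \<open>q \<le> N\<close> and \<open>c + sum_list ps < N\<close>. The
    \<open>+ 1\<close> admits \<open>q = 1\<close> even when all right periods vanish, as the bound
    on \<open>c + \<Sum>P\<close> requires; \<open>q = 0\<close> bounds \<open>c\<close>
    itself.\<close>
  have *: "c + q * \<Sum>(set ps) < N * N" if "q \<le> sum_list ps' + 1" for q
  proof -
    have "q * \<Sum>(set ps) \<le> N * sum_list ps"
      using that s by (intro mult_mono) (simp_all add: N length_encode_pair)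
    moreover have "N * c + N * sum_list ps < N * N"
      unfolding distrib_left[symmetric]
      by (rule mult_strict_left_mono) (simp_all add: N length_encode_pair)
    moreover have "c \<le> N * c"
      by (simp add: N length_encode_pair)
    ultimately show ?thesis by linarith
  qed
  show "c < N * N" using *[of 0] by simp
  have "c' < N" "N \<le> N * N"
    by (simp_all add: N length_encode_pair)
  then show "c' < N * N" by linarith
  have "q \<le> sum_list ps'" if "q \<in> set ps'" for q
    using that by (rule member_le_sum_list) simp
  then show "(\<forall>n<N * N. n \<in> linear_set c (set ps) \<longrightarrow> n \<in> linear_set c' (set ps')) \<longleftrightarrow>
      linear_set c (set ps) \<subseteq> linear_set c' (set ps')"
    using linear_set_subset_by_bound[of "set ps" "set ps'" c "N * N" c'] *[of 1] * by fastforce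
qed

lemma reach_halt:
  "\<exists>C. reach (poly time_poly (length w)) (init w) C \<and>
     fst C = (if w \<in> unary_containment then Acc else Rej)"
proof -
  let ?N = "length w"
  let ?B = "?N * ?N"
  let ?g = "cells ?N (\<lambda>_. {})"
  have init: "init w = (Scan False False, inp w, int (length ([] :: usym list)),
      cells (length ([] :: usym list)) (\<lambda>_. {}), int (length ([] :: usym list)),
      cells 0 (\<lambda>_. {}), int 0)"
    by (simp add: init_def cells_0)
  obtain C where C: "reach (Suc ?N) (init w) C"
    "if well_formed False False w
     then C = (Row, inp w, int ?N - 1, ?g, int ?N - 1, cells 0 (\<lambda>_. {}), int 0) else fst C = Rej"
    unfolding init
    using reach_scan[OF append_Nil[symmetric], where s = False and e = False] by blast
  show ?thesis
  proof (cases "well_formed False False w")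
    case False
    then have "w \<notin> unary_containment"
      by (auto simp: unary_containment_def well_formed_iff_encode_pair)
    moreover have "reach (poly time_poly ?N) (init w) C"
      using C(1) by (rule reach_mono) (simp add: poly_time_poly power4_eq_xxxx algebra_simps)
    ultimately show ?thesis using C(2) False by (intro exI[of _ C]) simp
  next
    case True
    then obtain c ps c' ps' where w: "w = encode_pair c ps c' ps'"
      by (auto simp: well_formed_iff_encode_pair)
    let ?u = "encode_linear c ps"
    let ?T = "?B * (2 * ?N + 4) + ?N + 4"
    define X where "X = (\<lambda>b. {})(False := linear_set c (set ps))"
    define Y where "Y = X(True := linear_set c' (set ps'))"
    have w1: "w = [] @ encode_linear c ps @ Semicolon # encode_linear c' ps'"
      and w2: "w = (?u @ [Semicolon]) @ encode_linear c' ps' @ []"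
      by (simp_all add: w encode_pair_def)
    have "inp w (int (length ?u)) = Inp Semicolon"
      using inp_append_nth[of 0 ?u "Semicolon # encode_linear c' ps'"] w1 by simp
    have "reach (Suc ?N) (init w)
        (Row, inp w, int ?N - 1, ?g, int ?N - 1, cells 0 (\<lambda>_. {}), int 0)"
      using C True by (simp only: if_True)
    also have "reach (?N * (2 * ?N + 3))
        (Row, inp w, int ?N - 1, ?g, int ?N - 1, cells 0 (\<lambda>_. {}), int 0)
        (Row, inp w, -1, ?g, int ?N - 1, cells ?B (\<lambda>_. {}), int ?B)"
      using reach_rows[of ?N "inp w" ?N "\<lambda>_. {}" 0] by (simp add: inp_inside)
    also have "reach 1 \<dots> (Back False, inp w, -1, ?g, int ?N - 1, cells ?B (\<lambda>_. {}), int ?B - 1)"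
      by (intro reach_step) (simp add: inp_outside)
    also have "reach (Suc ?B) \<dots> (Skip False, inp w, -1, ?g, int ?N - 1, cells ?B (\<lambda>_. {}), 0)"
      by (rule reach_back) simp
    also have "reach 1 \<dots>
        (Add False, inp w, int (length ([] :: usym list)), ?g, int ?N - 1, cells ?B (\<lambda>_. {}), 0)"
      by (intro reach_step) (simp add: inp_outside)
    also have "reach (2 * ?B + 4 + length ps * ?T) \<dots>
        (Next False, inp w, int (length ([] @ ?u)), ?g, int ?N - 1, cells ?B X, 0)"
      unfolding X_def using decision_bound(1) w by (intro reach_linear[OF w1]) auto
    also have "reach 1 \<dots>
        (Add True, inp w, int (length (?u @ [Semicolon])), ?g, int ?N - 1, cells ?B X, 0)"
      using \<open>inp w _ = _\<close> by (intro reach_step) simp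
    also have "reach (2 * ?B + 4 + length ps' * ?T) \<dots>
        (Next True, inp w, int (length ((?u @ [Semicolon]) @ encode_linear c' ps')), ?g,
          int ?N - 1, cells ?B Y, 0)"
      unfolding Y_def using decision_bound(2) w by (intro reach_linear[OF w2]) (auto simp: X_def)
    also have "reach 1 \<dots> (Check, inp w, int ?N, ?g, int ?N - 1, cells ?B Y, 0)"
      using w2 inp_outside[of "int ?N" w] by (intro reach_step) simp
    finally have check: "reach (Suc ?N + ?N * (2 * ?N + 3) + 1 + Suc ?B + 1
        + (2 * ?B + 4 + length ps * ?T) + 1 + (2 * ?B + 4 + length ps' * ?T) + 1)
        (init w) (Check, inp w, int ?N, ?g, int ?N - 1, cells ?B Y, 0)" .
    obtain D where D: "reach (Suc ?B) (Check, inp w, int ?N, ?g, int ?N - 1, cells ?B Y, 0) D"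
      "fst D = (if \<forall>n<?B. n \<in> Y False \<longrightarrow> n \<in> Y True then Acc else Rej)"
      using reach_verdict by blast
    have "length ps + length ps' \<le> ?N"
      by (simp add: w length_encode_pair)
    then have "reach (poly time_poly ?N) (init w) D"
      unfolding poly_time_poly
      by (rule reach_mono[OF reach_trans[OF check D(1)] time_bound])
    moreover have "fst D = (if w \<in> unary_containment then Acc else Rej)"
      using D(2) decision_bound(3)[of ?N c ps c' ps'] w
      by (simp add: X_def Y_def encode_pair_in_unary_containment)
    ultimately show ?thesis by blast
  qed
qed

lemma step_halted: "fst C \<in> {Acc, Rej} \<Longrightarrow> step C = C"
  by (cases C) auto

lemma steps_halted: "fst C \<in> {Acc, Rej} \<Longrightarrow> (step ^^ n) C = C"
  by (induction n) (simp_all add: step_halted)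

text \<open>\<open>decides_in_time\<close> inspects one exact moment; the absorbing halting states
  bridge the gap to the upper bound in \<open>reach\<close>.\<close>

lemma fst_steps_init:
  "fst ((step ^^ poly time_poly (length w)) (init w))
     = (if w \<in> unary_containment then Acc else Rej)"
proof -
  obtain C n where C: "n \<le> poly time_poly (length w)" "(step ^^ n) (init w) = C"
    "fst C = (if w \<in> unary_containment then Acc else Rej)"
    using reach_halt[of w] by (auto simp: reach_def)
  then have "(step ^^ poly time_poly (length w)) (init w)
      = (step ^^ (poly time_poly (length w) - n)) C"
    using funpow_add[of "poly time_poly (length w) - n" n step] by simp
  then show ?thesis
    using C(3) steps_halted[of C] by simp
qed


section \<open>Encoding as a Turing machine\<close>

definition machine :: "usym tm" where
  "machine =
     \<lparr>num_tapes = 3, states = range (to_nat :: st \<Rightarrow> nat),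
      tape_syms = {Blank} \<union> range Inp \<union> Work ` {..<4},
      start = to_nat (Scan False False), acc = to_nat Acc, rej = to_nat Rej,
      delta = (\<lambda>q ss. case nxt (from_nat q) (ss ! 0) (ss ! 1) (ss ! 2) of
        (q', d, a, a') \<Rightarrow> (to_nat q', [(ss ! 0, d), a, a']))\<rparr>"

text \<open>A bit is added only where it is missing, so values stay below 4.\<close>

lemma mark_in_tape_syms: "z \<in> tape_syms machine \<Longrightarrow> mark b z \<in> tape_syms machine"
proof (cases z)
  case (Work m)
  have "m + 1 < 4" if "even m" "m < 4"
    using that by presburger
  then show "z \<in> tape_syms machine \<Longrightarrow> ?thesis"
    using Work by (auto simp: machine_def image_iff)
qed simp_all

lemma nxt_in_tape_syms:
  assumes "nxt q x y z = (q', d, (y', d'), (z', d''))"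
    and "y \<in> tape_syms machine" "z \<in> tape_syms machine"
  shows "y' \<in> tape_syms machine" "z' \<in> tape_syms machine"
proof -
  have "Work 0 \<in> tape_syms machine"
    by (simp add: machine_def)
  moreover have "y' \<in> {y, Work 0}" "z' \<in> {z, Work 0} \<union> range (\<lambda>b. mark b z)"
    using assms(1) by (cases q; auto split: if_splits tsym.splits usym.splits)+
  ultimately show "y' \<in> tape_syms machine" "z' \<in> tape_syms machine"
    using assms(2,3) mark_in_tape_syms by auto
qed

lemma wf_machine: "wf_tm machine"
proof -
  have "case delta machine q ss of (q', as) \<Rightarrow>
      q' \<in> states machine \<and> length as = num_tapes machine \<and> fst ` set as \<subseteq> tape_syms machine"
    if ss: "ss \<in> lists (tape_syms machine)" "length ss = num_tapes machine" for q ss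
  proof -
    obtain q' d y' d' z' d'' where
      n: "nxt (from_nat q) (ss ! 0) (ss ! 1) (ss ! 2) = (q', d, (y', d'), (z', d''))"
      by (metis surj_pair)
    have "length ss = 3"
      using ss(2) by (simp add: machine_def)
    then have "ss ! i \<in> tape_syms machine" if "i < 3" for i
      using ss(1) that by (auto simp: in_lists_conv_set)
    then show ?thesis
      using n nxt_in_tape_syms[OF n] by (simp add: machine_def)
  qed
  then show ?thesis
    unfolding wf_tm_def by (auto simp: machine_def)
qed

fun config_of :: "cfg \<Rightarrow> usym config" where
  "config_of (q, f, i, g, j, h, k) = (to_nat q, [(f, i), (g, j), (h, k)])"

text \<open>Halted states are treated apart: \<open>tm_step\<close> freezes them by a test,
  \<open>step\<close> through the equations of \<open>nxt\<close> for \<open>Acc\<close> and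
  \<open>Rej\<close>. Elsewhere \<open>delta\<close> rewrites the symbol just read on the first
  tape, which leaves the input intact.\<close>

lemma tm_step_machine: "tm_step machine (config_of C) = config_of (step C)"
proof (cases "fst C \<in> {Acc, Rej}")
  case True
  then show ?thesis
    unfolding step_halted[OF True] by (cases C) (auto simp: tm_step_def machine_def)
next
  case False
  obtain q f i g j h k where C: "C = (q, f, i, g, j, h, k)"
    by (metis surj_pair)
  obtain q' d y d' z d'' where "nxt q (f i) (g j) (h k) = (q', d, (y, d'), (z, d''))"
    by (metis surj_pair)
  then show ?thesis
    using False by (simp add: C tm_step_def machine_def read_tape_def act_tape_def)
qed

lemma tm_steps_machine: "(tm_step machine ^^ n) (config_of C) = config_of ((step ^^ n) C)"
  by (induction n) (simp_all add: tm_step_machine)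

lemma init_config_machine: "init_config machine w = config_of (init w)"
  by (simp add: init_config_def machine_def init_def inp_def input_tape_def blank_tape_def
      numeral_eq_Suc)

theorem theorem3p5: "unary_containment \<in> class_P"
proof -
  have "fst (config_of C) = to_nat (fst C)" for C
    by (cases C) simp
  then have "decides_in_time machine unary_containment (poly time_poly)"
    by (simp add: decides_in_time_def init_config_machine tm_steps_machine fst_steps_init)
      (simp add: machine_def)
  then show ?thesis
    using wf_machine unfolding class_P_def by blast
qed

end
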